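(* Consider a $c$-server queueing system viewed as a function of (a) the sequence of arrival times $0\le t_1\le t_2\le t_3\le\dots$ and (b) the sequence of service durations $S_1,S_2,S_3,\dots$ assigned in order of initiation of service (the $n$-th service to be initiated has duration $S_n$), positive except for a possible initial subsequence of zeros. Let $0\le T'\le T$ be specified non-random times, and consider the following four allocation rules, applied with the same arrival times and the same sequence of service durations: 1. $\cdot/\cdot/c\;[RA]$ (random assignment) for all time; 2. $\cdot/\cdot/c\;[RA]$ until time $T$, then switching to $\cdot/\cdot/c\;[FCFS]$; 3. $\cdot/\cdot/c\;[RA]$ until time $T'$, then switching to $\cdot/\cdot/c\;[FCFS]$; 4. $\cdot/\cdot/c\;[FCFS]$ for all time. When initiations of service tie, the ties are broken using order of arrival time. On change of allocation rule to FCFS, customers in the system but not yet being served are placed at the front of the queue in order of arrival time, and service initiates immediately for the appropriate number of customers if there are servers free. Then, for $k=1,2,3$, case $k$ dominates case $k+1$, in the sense that, for every $m$, the $m$-th initiation of service in case $k+1$ occurs no later than the $m$-th initiation of service in case $k$, and the $m$-th departure in case $k+1$ occurs no later than the $m$-th departure in case $k$. Moreover, for all times $t\ge T'$ the Kiefer–Wolfowitz workload vector for case 3 dominates, coordinate by coordinate, that of case 4; and for all times $t\ge T$ the Kiefer–Wolfowitz workload vector for case 2 dominates, coordinate by coordinate, that of case 3.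
   Context: All systems are empty before the first arrival, and only finitely many customers arrive in any bounded time interval. **Allocation rules.** $[FCFS]$ (first-come-first-served): a single queue; customers initiate service in order of arrival, each as soon as a server is free for it. $[RA]$ (random assignment): each customer on arrival is assigned randomly (uniformly and independently) to one of the $c$ servers, without regard to loads, and each server serves the customers assigned to it in order of arrival. The same server assignments are used in cases 1, 2 and 3 while random assignment is in force, so these cases evolve identically up to the time of a change of rule. The assertions are pathwise: they hold for every realization of the assignments. **Service durations.** They are attached to services in order of initiation across the whole system: the $n$-th service to be initiated in each system has duration $S_n$ (not the service of the $n$-th customer to arrive). Departures are listed in chronological order, with multiplicity. **Kiefer–Wolfowitz workload vector.** At a time $t$ at which FCFS is in force (after all arrivals and any change of rule at time $t$), $\mathbf V(t)=(V(1,t)\le\dots\le V(c,t))$ is the increasingly ordered vector of residual work destined for each of the $c$ servers under continued FCFS: start with the residual service durations of the customers in service at the $c$ servers ($0$ for an idle server), then, for each waiting customer in order of arrival, add that customer's service duration (the next unused one in the sequence $S_1,S_2,\dots$) to the currently smallest coordinate, and sort in increasing order. Thereafter each arrival adds its service duration to the smallest coordinate, followed by re-sorting, and between arrivals each coordinate decreases at unit rate until it reaches $0$. *)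

theory Defs
  imports Complex_Main
begin

text \<open>
  Customers, services and servers are numbered from 0. A system is driven by the number of
  servers \<open>c\<close> (the servers are \<open>0, \<dots>, c - 1\<close>), the arrival times \<open>t i\<close> of the customers, the
  service durations \<open>S n\<close>, attached to services in order of initiation, and a realization \<open>a\<close>
  of the random assignments (customer \<open>i\<close> is assigned to server \<open>a i\<close>).
\<close>

datatype alloc_rule =
    RA
  | RA_then_FCFS real  \<comment> \<open>RA at times \<open>< T\<close>, FCFS at times \<open>\<ge> T\<close>\<close>
  | FCFS

text \<open>
  The system is generated one initiation of service at a time. Between two initiations we keep
  the set of customers whose service has been initiated and, for each server, the
  time at which its last service so far ends.
\<close>

record qstate =
  initiated :: "nat set"
  free_at :: "nat \<Rightarrow> real"

definition empty_system :: qstate where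
  "empty_system = \<lparr>initiated = {}, free_at = (\<lambda>_. 0)\<rparr>"

text \<open>
  The next initiation, as a triple (time, customer, server). Under RA, only the first
  not yet initiated customer of each server can be next, and it starts as soon as it has arrived
  and its server is free; the earliest such start is next, ties being broken in favour of
  the customer who arrived first.
\<close>

definition first_in_line :: "(nat \<Rightarrow> nat) \<Rightarrow> qstate \<Rightarrow> nat \<Rightarrow> bool" where
  "first_in_line a q i \<longleftrightarrow>
     i \<notin> initiated q \<and> (\<forall>i'<i. a i' = a i \<longrightarrow> i' \<in> initiated q)"

definition ra_next ::
    "(nat \<Rightarrow> real) \<Rightarrow> (nat \<Rightarrow> nat) \<Rightarrow> qstate \<Rightarrow> real \<times> nat \<times> nat" where
  "ra_next t a q =
     (let start = (\<lambda>i. max (t i) (free_at q (a i)));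
          i = (LEAST i. is_arg_min start (first_in_line a q) i)
      in (start i, i, a i))"

text \<open>
  Under FCFS, in force from time \<open>T\<close> on, the first customer not yet initiated is next, as soon as
  it has arrived and some server is free. It goes to the free server of least number; as
  service durations belong to services and not to servers, this choice is immaterial.
\<close>

definition fcfs_next ::
    "nat \<Rightarrow> (nat \<Rightarrow> real) \<Rightarrow> real \<Rightarrow> qstate \<Rightarrow> real \<times> nat \<times> nat" where
  "fcfs_next c t T q =
     (let i = (LEAST i. i \<notin> initiated q);
          s = max T (max (t i) (Min (free_at q ` {..<c})));
          j = (LEAST j. j < c \<and> free_at q j \<le> s)
      in (s, i, j))"

text \<open>
  With a change of rule at \<open>T\<close>, RA determines the next initiation as long as it produces one before
  \<open>T\<close>. Once it does not, it never does again, since FCFS initiations only remove customers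
  and increase \<open>free_at\<close>. For FCFS throughout, time starts at 0 as arrival times are nonnegative.
\<close>

fun next_initiation ::
    "nat \<Rightarrow> (nat \<Rightarrow> real) \<Rightarrow> (nat \<Rightarrow> nat) \<Rightarrow> alloc_rule \<Rightarrow> qstate \<Rightarrow> real \<times> nat \<times> nat" where
  "next_initiation c t a RA q = ra_next t a q"
| "next_initiation c t a (RA_then_FCFS T) q =
     (if fst (ra_next t a q) < T then ra_next t a q else fcfs_next c t T q)"
| "next_initiation c t a FCFS q = fcfs_next c t 0 q"

primrec state_after ::
    "nat \<Rightarrow> (nat \<Rightarrow> real) \<Rightarrow> (nat \<Rightarrow> real) \<Rightarrow> (nat \<Rightarrow> nat) \<Rightarrow> alloc_rule \<Rightarrow> nat \<Rightarrow> qstate" where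
  "state_after c t S a r 0 = empty_system"
| "state_after c t S a r (Suc n) =
     (let q = state_after c t S a r n;
          (s, i, j) = next_initiation c t a r q
      in \<lparr>initiated = insert i (initiated q), free_at = (free_at q)(j := s + S n)\<rparr>)"

definition initiation_time ::
    "nat \<Rightarrow> (nat \<Rightarrow> real) \<Rightarrow> (nat \<Rightarrow> real) \<Rightarrow> (nat \<Rightarrow> nat) \<Rightarrow> alloc_rule \<Rightarrow> nat \<Rightarrow> real" where
  "initiation_time c t S a r n = fst (next_initiation c t a r (state_after c t S a r n))"

text \<open>
  The family \<open>x\<close> listed in increasing order, with multiplicity. For the departure times below
  this listing exists (and it is always unique): only finitely many lie in a bounded interval.
\<close>

definition chronological :: "(nat \<Rightarrow> real) \<Rightarrow> nat \<Rightarrow> real" where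
  "chronological x = (THE d. mono d \<and> (\<exists>p. bij p \<and> d = x \<circ> p))"

definition departure_time ::
    "nat \<Rightarrow> (nat \<Rightarrow> real) \<Rightarrow> (nat \<Rightarrow> real) \<Rightarrow> (nat \<Rightarrow> nat) \<Rightarrow> alloc_rule \<Rightarrow> nat \<Rightarrow> real" where
  "departure_time c t S a r = chronological (\<lambda>n. initiation_time c t S a r n + S n)"

definition dominates ::
    "nat \<Rightarrow> (nat \<Rightarrow> real) \<Rightarrow> (nat \<Rightarrow> real) \<Rightarrow> (nat \<Rightarrow> nat) \<Rightarrow> alloc_rule \<Rightarrow> alloc_rule \<Rightarrow> bool" where
  "dominates c t S a r r' \<longleftrightarrow>
     (\<forall>m. initiation_time c t S a r' m \<le> initiation_time c t S a r m \<and>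
          departure_time c t S a r' m \<le> departure_time c t S a r m)"

definition add_to_smallest :: "real \<Rightarrow> real list \<Rightarrow> real list" where
  "add_to_smallest x v = sort ((hd v + x) # tl v)"

text \<open>
  The Kiefer--Wolfowitz vector at a time \<open>s\<close> at which FCFS is in force, after all arrivals and
  initiations at time \<open>s\<close>. If \<open>n\<close> services have been initiated and \<open>A\<close> customers have
  arrived by time \<open>s\<close>, the waiting customers account for the durations \<open>S n, \<dots>, S (A - 1)\<close>.
\<close>

definition workload ::
    "nat \<Rightarrow> (nat \<Rightarrow> real) \<Rightarrow> (nat \<Rightarrow> real) \<Rightarrow> (nat \<Rightarrow> nat) \<Rightarrow> alloc_rule \<Rightarrow> real \<Rightarrow> real list" where
  "workload c t S a r s =
     (let n = card {k. initiation_time c t S a r k \<le> s};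
          A = card {i. t i \<le> s};
          residual = (\<lambda>j. max 0 (free_at (state_after c t S a r n) j - s))
      in fold (\<lambda>k. add_to_smallest (S k)) [n..<A] (sort (map residual [0..<c])))"

end

theory Submission
  imports Defs "HOL-Library.Multiset"
begin

text \<open>
  A system with free times \<open>f\<close> is at least as advanced as one with free times \<open>g\<close>, seen from
  time \<open>x\<close> on, if at each time \<open>y \<ge> x\<close> at most as many servers are still committed beyond \<open>y\<close>
  under \<open>f\<close> as under \<open>g\<close>. An initiation at time \<open>x\<close> on a server free at \<open>x\<close> adds one to this number
  exactly for the \<open>y\<close> in \<open>[x, x + S n)\<close>, whichever free server it uses. So by induction on the
  number of initiations FCFS, which starts the next service as soon as possible, stays ahead of
  every other rule that has started from the same state. Departures follow by
  comparing order statistics, and the workload vectors because the one at time \<open>s\<close> consists of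
  the residuals at \<open>s\<close> once all customers arrived by time \<open>s\<close> have been initiated.
\<close>

section \<open>Order statistics\<close>

text \<open>Monotonicity makes the indices with value at most \<open>y\<close> an initial segment of
  the naturals, so bounds on single values become counts.\<close>

lemma mono_le_iff_less_card:
  fixes d :: "nat \<Rightarrow> real"
  assumes "mono d" and "finite {n. d n \<le> y}"
  shows "d m \<le> y \<longleftrightarrow> m < card {n. d n \<le> y}"
proof
  assume "d m \<le> y"
  then have "{..m} \<subseteq> {n. d n \<le> y}"
    using \<open>mono d\<close> by (auto dest: monoD intro: order_trans)
  then have "card {..m} \<le> card {n. d n \<le> y}"
    by (rule card_mono[OF assms(2)])
  then show "m < card {n. d n \<le> y}" by simp
next
  assume m: "m < card {n. d n \<le> y}"
  show "d m \<le> y"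
  proof (rule ccontr)
    assume "\<not> d m \<le> y"
    then have "{n. d n \<le> y} \<subseteq> {..<m}"
      using \<open>mono d\<close> by (smt (verit) lessThan_iff linorder_not_le mem_Collect_eq monoD subsetI)
    then have "card {n. d n \<le> y} \<le> card {..<m}"
      by (rule card_mono[OF finite_lessThan])
    with m show False by simp
  qed
qed

text \<open>The permutation maps the counted indices of \<open>d\<close> onto those of
  \<open>x\<close>. The count does not mention \<open>d\<close>, which is what makes the listing
  unique.\<close>

lemma sorted_listing_le_iff:
  fixes x d :: "nat \<Rightarrow> real"
  assumes fin: "finite {n. x n \<le> y}" and d: "mono d" "bij p" "d = x \<circ> p"
  shows "d m \<le> y \<longleftrightarrow> m < card {n. x n \<le> y}"
proof -
  have "p ` {n. d n \<le> y} = {n. x n \<le> y}"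
    using d by (auto simp: image_iff) (metis bij_pointE)
  then have "bij_betw p {n. d n \<le> y} {n. x n \<le> y}"
    using \<open>bij p\<close> by (auto simp: bij_betw_def intro: inj_on_subset)
  then have "card {n. d n \<le> y} = card {n. x n \<le> y}" "finite {n. d n \<le> y}"
    using fin by (auto simp: bij_betw_same_card bij_betw_finite)
  then show ?thesis using mono_le_iff_less_card[OF \<open>mono d\<close>] by metis
qed

lemma ex_sorted_listing:
  fixes x :: "nat \<Rightarrow> real"
  assumes fin: "\<And>y. finite {n. x n \<le> y}"
  shows "\<exists>p :: nat \<Rightarrow> nat. bij p \<and> mono (x \<circ> p)"
proof -
  \<comment> \<open>\<open>P n\<close> holds the predecessors of \<open>n\<close> when indices are
    ordered by value, ties by index; the rank \<open>r n\<close> is then the position of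
    \<open>n\<close> in the listing.\<close>
  define P where "P n = {k. x k < x n \<or> x k = x n \<and> k < n}" for n
  define r where "r n = card (P n)" for n
  have finP: "finite (P n)" for n
    by (rule finite_subset[OF _ fin[of "x n"]]) (auto simp: P_def)
  have r_less: "r k < r n" if "k \<in> P n" for k n
    unfolding r_def
    by (rule psubset_card_mono[OF finP]) (use that in \<open>auto simp: P_def\<close>)
  have total: "k \<in> P n \<or> n \<in> P k" if "k \<noteq> n" for k n
    using that by (auto simp: P_def)
  have "inj r"
    by (rule injI) (metis total r_less less_irrefl)
  \<comment> \<open>The \<open>r n\<close> predecessors have distinct ranks below
    \<open>r n\<close>, so they take every such rank.\<close>
  have initial: "{..<r n} \<subseteq> range r" for n
  proof -
    have "card (r ` P n) = card {..<r n}"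
      using inj_on_subset[OF \<open>inj r\<close>] by (simp add: card_image r_def[of n])
    then have "r ` P n = {..<r n}"
      using r_less by (intro card_subset_eq) auto
    then show ?thesis by auto
  qed
  have "infinite (range r)"
    using \<open>inj r\<close> by (simp add: finite_image_iff)
  then have "\<exists>n. m < r n" for m
    by (metis (no_types, lifting) finite_nat_set_iff_bounded_le imageE linorder_not_le)
  then have "surj r"
    using initial by (metis lessThan_iff subsetD surjI surj_def rangeE)
  with \<open>inj r\<close> have "bij r" by (simp add: bij_def)
  have "mono (x \<circ> inv r)"
  proof (rule monoI, rule ccontr)
    fix m m' :: nat
    assume "m \<le> m'" and "\<not> (x \<circ> inv r) m \<le> (x \<circ> inv r) m'"
    then have "inv r m' \<in> P (inv r m)" by (auto simp: P_def)
    then have "m' < m" using r_less \<open>surj r\<close> by (metis surj_f_inv_f)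
    with \<open>m \<le> m'\<close> show False by simp
  qed
  with bij_imp_bij_inv[OF \<open>bij r\<close>] show ?thesis by blast
qed

lemma chronological_le_iff:
  fixes x :: "nat \<Rightarrow> real"
  assumes fin: "\<And>y. finite {n. x n \<le> y}"
  shows "chronological x m \<le> y \<longleftrightarrow> m < card {n. x n \<le> y}"
proof -
  have "\<exists>!d :: nat \<Rightarrow> real. mono d \<and> (\<exists>p. bij p \<and> d = x \<circ> p)"
  proof (rule ex_ex1I)
    show "\<exists>d :: nat \<Rightarrow> real. mono d \<and> (\<exists>p. bij p \<and> d = x \<circ> p)"
      using ex_sorted_listing[OF fin] by blast
  next
    fix d e :: "nat \<Rightarrow> real"
    assume "mono d \<and> (\<exists>p. bij p \<and> d = x \<circ> p)" "mono e \<and> (\<exists>p. bij p \<and> e = x \<circ> p)"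
    then have "d m \<le> y \<longleftrightarrow> e m \<le> y" for m y
      using sorted_listing_le_iff[OF fin] by blast
    then show "d = e" by (intro ext antisym) blast+
  qed
  from theI'[OF this] obtain p where "mono (chronological x)" "bij p" "chronological x = x \<circ> p"
    unfolding chronological_def by blast
  then show ?thesis by (rule sorted_listing_le_iff[OF fin])
qed

text \<open>Smaller entries can only raise the count below a threshold; the threshold that decides
  is the \<open>m\<close>-th value in the listing of \<open>x'\<close>.\<close>

lemma chronological_mono:
  fixes x x' :: "nat \<Rightarrow> real"
  assumes fin: "\<And>y. finite {n. x n \<le> y}" and le: "\<And>n. x n \<le> x' n"
  shows "chronological x m \<le> chronological x' m"
proof -
  have sub: "{n. x' n \<le> y} \<subseteq> {n. x n \<le> y}" for y
    using le by (auto intro: order_trans)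
  then have fin': "finite {n. x' n \<le> y}" for y
    using fin finite_subset by blast
  let ?y = "chronological x' m"
  have "m < card {n. x' n \<le> ?y}"
    using chronological_le_iff[OF fin', of m ?y] by simp
  also have "\<dots> \<le> card {n. x n \<le> ?y}"
    by (rule card_mono[OF fin sub])
  finally show ?thesis
    using chronological_le_iff[OF fin] by simp
qed

text \<open>One threshold suffices: if \<open>xs ! k\<close> exceeded \<open>ys ! k\<close>, so
  would at least \<open>length xs - k\<close> entries of \<open>xs\<close>, against at most
  \<open>length xs - k - 1\<close> entries of \<open>ys\<close>.\<close>

lemma sorted_nth_le_nth:
  fixes xs ys :: "'a::linorder list"
  assumes "sorted xs" "sorted ys" and len: "length xs = length ys" and k: "k < length xs"
    and count: "size {#x \<in># mset xs. ys ! k < x#} \<le> size {#x \<in># mset ys. ys ! k < x#}"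
  shows "xs ! k \<le> ys ! k"
proof (rule ccontr)
  let ?y = "ys ! k"
  assume "\<not> xs ! k \<le> ?y"
  then have "{k..<length xs} \<subseteq> {i. i < length xs \<and> ?y < xs ! i}"
    using \<open>sorted xs\<close> by (auto simp: sorted_iff_nth_mono not_le intro: less_le_trans)
  then have "card {k..<length xs} \<le> card {i. i < length xs \<and> ?y < xs ! i}"
    by (rule card_mono[rotated]) simp
  also have "\<dots> \<le> card {i. i < length ys \<and> ?y < ys ! i}"
    using count by (simp add: length_filter_conv_card flip: mset_filter)
  also have "\<dots> \<le> card {Suc k..<length ys}"
  proof (rule card_mono)
    show "{i. i < length ys \<and> ?y < ys ! i} \<subseteq> {Suc k..<length ys}"
      using \<open>sorted ys\<close> k len by (auto simp: sorted_iff_nth_mono Suc_le_eq not_le[symmetric])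
  qed simp
  finally show False using k len by simp
qed

text \<open>Turns a step of the workload recursion into an update of one server. Any
  \<open>j\<close> attaining the minimum will do, since sorting forgets the labels.\<close>

lemma add_to_smallest_sort:
  fixes g :: "nat \<Rightarrow> real"
  assumes j: "j < c" and least: "\<And>i. i < c \<Longrightarrow> g j \<le> g i"
  shows "add_to_smallest x (sort (map g [0..<c])) = sort (map (g(j := g j + x)) [0..<c])"
proof -
  let ?xs = "map g [0..<c]" and ?R = "mset_set ({0..<c} - {j})"
  have split: "mset_set {0..<c} = add_mset j ?R"
    using j by (simp add: mset_set.remove)
  obtain y ys where ys: "sort ?xs = y # ys"
    using j by (cases "sort ?xs") (auto simp flip: length_0_conv)
  then have set: "set (y # ys) = g ` {0..<c}"
    by (metis set_sort set_map set_upt)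
  have "sorted (y # ys)" by (metis ys sorted_sort)
  have "g j \<in> set (y # ys)" using j unfolding set by simp
  with \<open>sorted (y # ys)\<close> have "y \<le> g j" by auto
  moreover have "y \<in> g ` {0..<c}" using set by (metis list.set_intros(1))
  then have "g j \<le> y" using least by auto
  ultimately have "y = g j" by simp
  moreover have "mset (y # ys) = image_mset g (add_mset j ?R)"
    using split by (metis ys mset_sort mset_map mset_upt)
  ultimately have "mset ys = image_mset g ?R" by simp
  also have "\<dots> = image_mset (g(j := g j + x)) ?R"
    by (rule image_mset_cong) simp
  finally have "mset ((g j + x) # ys) = mset (map (g(j := g j + x)) [0..<c])"
    by (simp add: split)
  then have "sort ((g j + x) # ys) = sort (map (g(j := g j + x)) [0..<c])"
    by (intro properties_for_sort) (simp_all only: mset_sort sorted_sort)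
  then show ?thesis
    by (simp add: add_to_smallest_def ys \<open>y = g j\<close>)
qed

section \<open>Initiations\<close>

definition next_time ::
    "nat \<Rightarrow> (nat \<Rightarrow> real) \<Rightarrow> (nat \<Rightarrow> nat) \<Rightarrow> alloc_rule \<Rightarrow> qstate \<Rightarrow> real" where
  "next_time c t a r q = fst (next_initiation c t a r q)"

text \<open>Orders the states along one run; different rules are compared by \<open>busy\<close>
  instead.\<close>

definition state_le :: "qstate \<Rightarrow> qstate \<Rightarrow> bool" where
  "state_le q q' \<longleftrightarrow> initiated q \<subseteq> initiated q' \<and> free_at q \<le> free_at q'"

locale queue =
  fixes c :: nat and t S :: "nat \<Rightarrow> real" and a :: "nat \<Rightarrow> nat"
  assumes servers: "c \<ge> 1"
    and assignment: "\<And>i. a i < c"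
    and arrivals_nonneg: "\<And>i. 0 \<le> t i"
    and arrivals_mono: "mono t"
    and arrivals_locally_finite: "\<And>x. finite {i. t i \<le> x}"
    and durations_nonneg: "\<And>n. 0 \<le> S n"
begin

abbreviation "state r n \<equiv> state_after c t S a r n"
abbreviation "init_time r n \<equiv> initiation_time c t S a r n"
abbreviation "ra_time q \<equiv> fst (ra_next t a q)"

section \<open>The next initiation as a function of the state\<close>

lemma ex_uninitiated: "finite I \<Longrightarrow> \<exists>i. i \<notin> I" for I :: "nat set"
  using ex_new_if_finite infinite_UNIV_nat by blast

text \<open>Customers of one server share its free time and the first of them arrived first, so the
  minimum over those first in line is a minimum over all uninitiated customers.\<close>

lemma ra_next_eq:
  assumes fin: "finite (initiated q)"
  obtains i where "ra_next t a q = (max (t i) (free_at q (a i)), i, a i)" "i \<notin> initiated q"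
    "\<And>k. k \<notin> initiated q \<Longrightarrow> max (t i) (free_at q (a i)) \<le> max (t k) (free_at q (a k))"
proof -
  let ?start = "\<lambda>i. max (t i) (free_at q (a i))" and ?P = "first_in_line a q"
  define i where "i = (LEAST i. is_arg_min ?start ?P i)"
  have first: "\<exists>i. ?P i \<and> i \<le> k \<and> a i = a k" if "k \<notin> initiated q" for k
  proof -
    define l where "l = (LEAST i. i \<notin> initiated q \<and> a i = a k)"
    have l: "l \<notin> initiated q \<and> a l = a k"
      unfolding l_def by (rule LeastI[where k = k]) (use that in simp)
    have "l \<le> k"
      unfolding l_def by (rule Least_le) (use that in simp)
    moreover have "i' \<in> initiated q" if "i' < l" "a i' = a l" for i'
      using not_less_Least[OF that(1)[unfolded l_def]] that(2) l by simp
    ultimately show ?thesis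
      using l by (auto simp: first_in_line_def)
  qed
  \<comment> \<open>Each server has at most one customer first in line, so the minimum is over a
    finite set.\<close>
  have "inj_on a {i. ?P i}"
    by (rule inj_onI) (metis first_in_line_def linorder_neqE_nat mem_Collect_eq)
  then have "finite {i. ?P i}"
    by (rule finite_imageD[rotated])
      (rule finite_subset[of _ "{..<c}"], use assignment in auto)
  moreover have "{i. ?P i} \<noteq> {}"
    using ex_uninitiated[OF fin] first by blast
  ultimately have "\<exists>i. is_arg_min ?start ?P i"
    using ex_is_arg_min_if_finite[of "{i. ?P i}" ?start] by simp
  then have min: "is_arg_min ?start ?P i"
    unfolding i_def by (rule LeastI_ex)
  show ?thesis
  proof (rule that)
    show "ra_next t a q = (?start i, i, a i)"
      by (simp add: ra_next_def Let_def i_def)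
    show "i \<notin> initiated q"
      using min by (simp add: is_arg_min_def first_in_line_def)
    fix k assume "k \<notin> initiated q"
    then obtain k' where k': "?P k'" "k' \<le> k" "a k' = a k" using first by blast
    then have "?start i \<le> ?start k'"
      using min by (auto simp: is_arg_min_def not_less)
    also have "\<dots> \<le> ?start k"
      using k' monoD[OF arrivals_mono k'(2)] by auto
    finally show "?start i \<le> ?start k" .
  qed
qed

lemma fcfs_next_eq:
  assumes fin: "finite (initiated q)"
  obtains i s j where "fcfs_next c t \<tau> q = (s, i, j)" "i = (LEAST i. i \<notin> initiated q)"
    "s = max \<tau> (max (t i) (Min (free_at q ` {..<c})))"
    "i \<notin> initiated q" "j < c" "free_at q j \<le> s"
proof -
  define i where "i = (LEAST i. i \<notin> initiated q)"
  define s where "s = max \<tau> (max (t i) (Min (free_at q ` {..<c})))"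
  define j where "j = (LEAST j. j < c \<and> free_at q j \<le> s)"
  have "i \<notin> initiated q"
    unfolding i_def by (rule LeastI_ex) (rule ex_uninitiated[OF fin])
  have "Min (free_at q ` {..<c}) \<in> free_at q ` {..<c}"
    using servers by (intro Min_in) (auto simp: lessThan_empty_iff)
  then have "\<exists>j. j < c \<and> free_at q j \<le> s"
    by (auto simp: s_def)
  then have "j < c \<and> free_at q j \<le> s"
    unfolding j_def by (rule LeastI_ex)
  moreover have "fcfs_next c t \<tau> q = (s, i, j)"
    by (simp add: fcfs_next_def Let_def i_def s_def j_def)
  ultimately show ?thesis
    using that i_def s_def \<open>i \<notin> initiated q\<close> by blast
qed

lemma next_initiation_admissible:
  assumes "finite (initiated q)" "next_initiation c t a r q = (s, i, j)"
  shows "i \<notin> initiated q" "t i \<le> s" "j < c" "free_at q j \<le> s"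
proof -
  have "i \<notin> initiated q \<and> t i \<le> s \<and> j < c \<and> free_at q j \<le> s"
    if "ra_next t a q = (s, i, j)"
    using ra_next_eq[OF assms(1)] that assignment by (metis max.cobounded1 max.cobounded2 prod.inject)
  moreover have "i \<notin> initiated q \<and> t i \<le> s \<and> j < c \<and> free_at q j \<le> s"
    if "fcfs_next c t \<tau> q = (s, i, j)" for \<tau>
    using fcfs_next_eq[OF assms(1), of \<tau>] that
    by (metis max.cobounded1 max.coboundedI2 prod.inject)
  ultimately have "i \<notin> initiated q \<and> t i \<le> s \<and> j < c \<and> free_at q j \<le> s"
    using assms(2) by (cases r) (auto split: if_splits)
  then show "i \<notin> initiated q" "t i \<le> s" "j < c" "free_at q j \<le> s" by auto
qed

text \<open>The customer chosen in the larger state is still a candidate in the smaller one, where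
  it could start no later.\<close>

lemma ra_time_mono:
  assumes "finite (initiated q)" "finite (initiated q')" "state_le q q'"
  shows "ra_time q \<le> ra_time q'"
proof -
  obtain i where i: "ra_next t a q' = (max (t i) (free_at q' (a i)), i, a i)" "i \<notin> initiated q'"
    using ra_next_eq[OF assms(2)] by metis
  then have "i \<notin> initiated q" using assms(3) by (auto simp: state_le_def)
  then have "ra_time q \<le> max (t i) (free_at q (a i))"
    using ra_next_eq[OF assms(1)] by (metis fst_conv)
  also have "\<dots> \<le> max (t i) (free_at q' (a i))"
    using assms(3) by (intro max.mono) (auto simp: state_le_def le_fun_def)
  finally show ?thesis using i by simp
qed

lemma fcfs_time_mono:
  assumes "finite (initiated q)" "finite (initiated q')" "state_le q q'"
  shows "fst (fcfs_next c t \<tau> q) \<le> fst (fcfs_next c t \<tau> q')"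
proof -
  have "(LEAST i. i \<notin> initiated q) \<le> (LEAST i. i \<notin> initiated q')"
    using assms(3) LeastI_ex[OF ex_uninitiated[OF assms(2)]]
    by (auto simp: state_le_def intro: Least_le)
  then have "t (LEAST i. i \<notin> initiated q) \<le> t (LEAST i. i \<notin> initiated q')"
    by (rule monoD[OF arrivals_mono])
  moreover have "Min (free_at q ` {..<c}) \<le> Min (free_at q' ` {..<c})"
  proof (rule Min.boundedI)
    fix y assume "y \<in> free_at q' ` {..<c}"
    then obtain j where j: "j < c" "y = free_at q' j" by auto
    then have "Min (free_at q ` {..<c}) \<le> free_at q j" by simp
    also have "\<dots> \<le> y" using assms(3) j by (simp add: state_le_def le_fun_def)
    finally show "Min (free_at q ` {..<c}) \<le> y" .
  qed (use servers in \<open>auto simp: lessThan_empty_iff\<close>)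
  ultimately show ?thesis
    by (auto simp: fcfs_next_def Let_def intro!: max.mono)
qed

lemma fcfs_time_ge: "\<tau> \<le> fst (fcfs_next c t \<tau> q)"
  by (simp add: fcfs_next_def Let_def)

lemma next_time_mono:
  assumes "finite (initiated q)" "finite (initiated q')" "state_le q q'"
  shows "next_time c t a r q \<le> next_time c t a r q'"
proof (cases r)
  \<comment> \<open>If only \<open>q'\<close> has switched, its FCFS start is at least
    \<open>\<tau>\<close>, hence after the RA start of \<open>q\<close>; that only \<open>q\<close>
    has switched is excluded by \<open>ra_time_mono\<close>.\<close>
  case (RA_then_FCFS \<tau>)
  then show ?thesis
    using ra_time_mono[OF assms] fcfs_time_mono[OF assms, of \<tau>] fcfs_time_ge[of \<tau> q']
    by (auto simp: next_time_def)
qed (use ra_time_mono[OF assms] fcfs_time_mono[OF assms] in \<open>auto simp: next_time_def\<close>)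

section \<open>The run generated by a rule\<close>

lemma state_Suc:
  assumes "next_initiation c t a r (state r n) = (s, i, j)"
  shows "state r (Suc n) = \<lparr>initiated = insert i (initiated (state r n)),
    free_at = (free_at (state r n))(j := s + S n)\<rparr>"
  using assms by (simp add: Let_def)

lemma init_time_eq: "init_time r n = next_time c t a r (state r n)"
  by (simp add: initiation_time_def next_time_def)

lemma finite_initiated: "finite (initiated (state r n))"
  by (induction n) (auto simp: empty_system_def Let_def split: prod.split)

lemma init_stepE:
  obtains i j where "next_initiation c t a r (state r n) = (init_time r n, i, j)"
    "i \<notin> initiated (state r n)" "t i \<le> init_time r n"
    "j < c" "free_at (state r n) j \<le> init_time r n"
    "initiated (state r (Suc n)) = insert i (initiated (state r n))"
    "free_at (state r (Suc n)) = (free_at (state r n))(j := init_time r n + S n)"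
proof -
  obtain s i j where n: "next_initiation c t a r (state r n) = (s, i, j)"
    by (metis prod_cases3)
  then have "s = init_time r n" by (simp add: initiation_time_def)
  with n state_Suc[OF n] next_initiation_admissible[OF finite_initiated n]
  show ?thesis by (intro that[of i j]) simp_all
qed

lemma card_initiated: "card (initiated (state r n)) = n"
proof (induction n)
  case (Suc n)
  then show ?case
    using init_stepE[of r n] finite_initiated[of r n] by (metis card_insert_disjoint)
qed (simp add: empty_system_def)

lemma state_le_Suc: "state_le (state r n) (state r (Suc n))"
proof -
  obtain i j where "free_at (state r n) j \<le> init_time r n"
    "initiated (state r (Suc n)) = insert i (initiated (state r n))"
    "free_at (state r (Suc n)) = (free_at (state r n))(j := init_time r n + S n)"
    using init_stepE[of r n] by metis
  then show ?thesis
    using durations_nonneg[of n] by (auto simp: state_le_def le_fun_def)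
qed

text \<open>Chronological order is not built into the construction; it follows because the state
  only grows.\<close>

lemma mono_init_time: "mono (init_time r)"
  unfolding init_time_eq mono_iff_le_Suc
  by (intro allI next_time_mono finite_initiated state_le_Suc)

lemma ra_time_le_Suc: "ra_time (state r n) \<le> ra_time (state r (Suc n))"
  by (intro ra_time_mono finite_initiated state_le_Suc)

lemma initiated_arrived:
  "i \<in> initiated (state r (Suc n)) \<Longrightarrow> t i \<le> init_time r n"
proof (induction n)
  case 0
  obtain k where "initiated (state r (Suc 0)) = insert k (initiated (state r 0))" "t k \<le> init_time r 0"
    by (rule init_stepE[of r 0]) blast
  with 0 show ?case by (simp add: empty_system_def del: state_after.simps(2))
next
  case (Suc n)
  obtain k where "initiated (state r (Suc (Suc n))) = insert k (initiated (state r (Suc n)))"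
    "t k \<le> init_time r (Suc n)"
    by (rule init_stepE[of r "Suc n"]) blast
  moreover have "init_time r n \<le> init_time r (Suc n)"
    by (rule monoD[OF mono_init_time]) simp
  ultimately show ?case
    using Suc by (auto simp del: state_after.simps intro: order_trans)
qed

text \<open>Pigeonhole: one of the first \<open>n + 1\<close> customers served lies outside
  \<open>I\<close>. Below, \<open>I\<close> is the set initiated in another system, which may have
  served other customers.\<close>

lemma arrival_le_init_time_if_card:
  assumes "finite I" "card I \<le> n"
  shows "t (LEAST i. i \<notin> I) \<le> init_time r n"
proof -
  have "\<not> initiated (state r (Suc n)) \<subseteq> I"
    using assms card_mono[OF assms(1)] card_initiated[of r "Suc n"]
    by (metis Suc_n_not_le_n order_trans)
  then obtain i where i: "i \<in> initiated (state r (Suc n))" "i \<notin> I" by blast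
  then have "t (LEAST i. i \<notin> I) \<le> t i"
    by (intro monoD[OF arrivals_mono] Least_le)
  with initiated_arrived[OF i(1)] show ?thesis by linarith
qed

lemma arrival_le_init_time: "t n \<le> init_time r n"
proof -
  have "(LEAST i. i \<notin> {..<n}) = n"
    by (rule Least_equality) auto
  then show ?thesis
    using arrival_le_init_time_if_card[of "{..<n}" n r] by simp
qed

section \<open>Domination\<close>

text \<open>A count, because two systems may put the same service on different servers.\<close>

definition busy :: "qstate \<Rightarrow> real \<Rightarrow> nat" where
  "busy q y = card {j. j < c \<and> y < free_at q j}"

lemma busy_fun_upd:
  assumes "j < c" "free_at q j \<le> y" "free_at q' = (free_at q)(j := v)"
  shows "busy q' y = busy q y + (if y < v then 1 else 0)"
proof -
  have "{k. k < c \<and> y < free_at q' k} =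
      (if y < v then insert j else id) {k. k < c \<and> y < free_at q k}"
    using assms by auto
  then show ?thesis using assms(2) by (simp add: busy_def)
qed

lemma busy_less_iff: "busy q y < c \<longleftrightarrow> (\<exists>j<c. free_at q j \<le> y)"
proof
  assume less: "busy q y < c"
  show "\<exists>j<c. free_at q j \<le> y"
  proof (rule ccontr)
    assume "\<not> ?thesis"
    then have "{j. j < c \<and> y < free_at q j} = {..<c}" by (auto simp: not_le)
    with less show False by (simp add: busy_def)
  qed
next
  assume "\<exists>j<c. free_at q j \<le> y"
  then obtain j where "j \<in> {..<c}" "j \<notin> {j. j < c \<and> y < free_at q j}" by (auto simp: not_less)
  then have "{j. j < c \<and> y < free_at q j} \<subset> {..<c}" by blast
  then have "busy q y < card {..<c}"
    unfolding busy_def by (rule psubset_card_mono[OF finite_lessThan])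
  then show "busy q y < c" by simp
qed

text \<open>The rules that follow RA at least up to \<open>\<tau>\<close>, with RA itself as a
  switch at infinity; one argument then covers all three dominations.\<close>

inductive later_switch :: "alloc_rule \<Rightarrow> real \<Rightarrow> bool" where
  "later_switch RA \<tau>"
| "\<tau> \<le> T \<Longrightarrow> later_switch (RA_then_FCFS T) \<tau>"

lemma later_switch_next_initiation:
  assumes "later_switch r \<tau>"
  shows "ra_time q < \<tau> \<Longrightarrow> next_initiation c t a r q = ra_next t a q"
    and "\<tau> \<le> ra_time q \<Longrightarrow> \<tau> \<le> next_time c t a r q"
  using assms by (auto elim!: later_switch.cases simp: next_time_def
      intro: order_trans[OF _ fcfs_time_ge])

text \<open>Both rules make the same RA moves before \<open>\<tau>\<close>. The second alternative
  persists, since the next RA start never moves back along a run.\<close>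

lemma same_state_or_switched:
  assumes "later_switch r \<tau>"
  shows "state r n = state (RA_then_FCFS \<tau>) n \<or>
    \<tau> \<le> ra_time (state r n) \<and> \<tau> \<le> ra_time (state (RA_then_FCFS \<tau>) n)"
proof (induction n)
  case (Suc n)
  show ?case
  proof (cases "\<tau> \<le> ra_time (state r n) \<and> \<tau> \<le> ra_time (state (RA_then_FCFS \<tau>) n)")
    case True
    then show ?thesis using ra_time_le_Suc order_trans by blast
  next
    case False
    with Suc have eq: "state r n = state (RA_then_FCFS \<tau>) n" and "ra_time (state r n) < \<tau>"
      by auto
    then have "next_initiation c t a r (state r n) =
        next_initiation c t a (RA_then_FCFS \<tau>) (state (RA_then_FCFS \<tau>) n)"
      using later_switch_next_initiation(1)[OF assms] by simp
    with eq show ?thesis by simp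
  qed
qed simp

text \<open>The induction hypothesis is a premise, so that one step serves both
  \<open>busy_le\<close> and \<open>init_time_le\<close>.\<close>

lemma later_switch_init_step:
  assumes r: "later_switch r \<tau>"
    and IH: "\<And>y. (\<And>m. m < n \<Longrightarrow> init_time r m \<le> y) \<Longrightarrow>
      busy (state (RA_then_FCFS \<tau>) n) y \<le> busy (state r n) y"
  shows "init_time (RA_then_FCFS \<tau>) n \<le> init_time r n \<and>
    (state r (Suc n) = state (RA_then_FCFS \<tau>) (Suc n) \<or>
      (\<forall>y\<ge>init_time r n. busy (state (RA_then_FCFS \<tau>) (Suc n)) y \<le> busy (state r (Suc n)) y))"
proof -
  let ?r' = "RA_then_FCFS \<tau>"
  let ?q = "state r n" and ?q' = "state ?r' n" and ?s = "init_time r n"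
  show ?thesis
  proof (cases "\<tau> \<le> ra_time ?q \<and> \<tau> \<le> ra_time ?q'")
    case False
    with same_state_or_switched[OF r] have eq: "?q = ?q'" and "ra_time ?q < \<tau>"
      by (metis, metis not_le)
    then have "next_initiation c t a r ?q = next_initiation c t a ?r' ?q'"
      using later_switch_next_initiation(1)[OF r] by simp
    with eq show ?thesis by (simp add: initiation_time_def)
  next
    case True
    obtain j where j: "j < c" "free_at ?q j \<le> ?s"
      "free_at (state r (Suc n)) = (free_at ?q)(j := ?s + S n)"
      using init_stepE[of r n] by metis
    obtain j' where j': "j' < c" "free_at ?q' j' \<le> init_time ?r' n"
      "free_at (state ?r' (Suc n)) = (free_at ?q')(j' := init_time ?r' n + S n)"
      using init_stepE[of ?r' n] by metis
    have IH': "busy ?q' y \<le> busy ?q y" if "?s \<le> y" for y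
      using that monoD[OF mono_init_time, of _ n r] by (intro IH) (meson less_imp_le order_trans)
    \<comment> \<open>The slower system has a server free at \<open>?s\<close>, so by the count the
      faster one has too. With an arrived customer left and \<open>\<tau>\<close> passed, FCFS must
      start by \<open>?s\<close>.\<close>
    have "busy ?q ?s < c" using j by (auto simp: busy_less_iff)
    then have "busy ?q' ?s < c" using IH'[of ?s] by simp
    then obtain k where "k < c" "free_at ?q' k \<le> ?s" by (auto simp: busy_less_iff)
    then have "Min (free_at ?q' ` {..<c}) \<le> ?s"
      by (intro order_trans[OF Min_le]) auto
    moreover have "t (LEAST i. i \<notin> initiated ?q') \<le> ?s"
      by (intro arrival_le_init_time_if_card finite_initiated) (simp add: card_initiated)
    moreover have "\<tau> \<le> ?s"
      using later_switch_next_initiation(2)[OF r] True by (simp add: init_time_eq)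
    ultimately have le: "init_time ?r' n \<le> ?s"
      using True by (simp add: initiation_time_def fcfs_next_def Let_def)
    \<comment> \<open>The same duration after an earlier start ends no later, so whenever the left
      count gains one, the right count does.\<close>
    have "busy (state ?r' (Suc n)) y \<le> busy (state r (Suc n)) y" if "?s \<le> y" for y
    proof -
      have "busy (state ?r' (Suc n)) y = busy ?q' y + (if y < init_time ?r' n + S n then 1 else 0)"
        by (rule busy_fun_upd[OF j'(1) _ j'(3)]) (use j' le that in linarith)
      moreover have "busy (state r (Suc n)) y = busy ?q y + (if y < ?s + S n then 1 else 0)"
        by (rule busy_fun_upd[OF j(1) _ j(3)]) (use j that in linarith)
      ultimately show ?thesis using IH'[OF that] le by simp
    qed
    with le show ?thesis by blast
  qed
qed

text \<open>For earlier \<open>y\<close> the bound can fail: under RA a service may wait behind a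
  long one while another server idles, which FCFS would have used.\<close>

lemma busy_le:
  assumes r: "later_switch r \<tau>" and "\<And>m. m < n \<Longrightarrow> init_time r m \<le> y"
  shows "busy (state (RA_then_FCFS \<tau>) n) y \<le> busy (state r n) y"
  using assms(2)
proof (induction n arbitrary: y)
  case (Suc n)
  have "busy (state (RA_then_FCFS \<tau>) n) y \<le> busy (state r n) y"
    if "\<And>m. m < n \<Longrightarrow> init_time r m \<le> y" for y
    using Suc.IH that by blast
  from later_switch_init_step[OF r this] Suc.prems[of n] show ?case by auto
qed simp

lemma init_time_le:
  assumes "later_switch r \<tau>"
  shows "init_time (RA_then_FCFS \<tau>) n \<le> init_time r n"
  using later_switch_init_step[OF assms busy_le[OF assms]] by blast

lemma dominates_if_init_time_le:
  assumes "\<And>n. init_time r' n \<le> init_time r n"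
  shows "dominates c t S a r r'"
proof -
  \<comment> \<open>The \<open>n\<close>-th departure candidate is no earlier than the
    \<open>n\<close>-th arrival.\<close>
  have "finite {n. init_time r' n + S n \<le> y}" for y
  proof (rule finite_subset[OF _ arrivals_locally_finite[of y]])
    show "{n. init_time r' n + S n \<le> y} \<subseteq> {i. t i \<le> y}"
      using arrival_le_init_time durations_nonneg
      by (smt (verit) Collect_mono)
  qed
  then show ?thesis
    using assms unfolding dominates_def departure_time_def
    by (auto intro!: chronological_mono)
qed

section \<open>Workload\<close>

text \<open>The starting vector in \<open>workload\<close>, but for any state, including one run
  ahead to initiations after \<open>s\<close>.\<close>

definition residuals :: "qstate \<Rightarrow> real \<Rightarrow> real list" where
  "residuals q s = sort (map (\<lambda>j. max 0 (free_at q j - s)) [0..<c])"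

lemma arrived_iff: "t i \<le> s \<longleftrightarrow> i < card {i. t i \<le> s}"
  by (rule mono_le_iff_less_card[OF arrivals_mono arrivals_locally_finite])

lemma finite_initiations: "finite {k. init_time r k \<le> s}"
  by (rule finite_subset[OF _ arrivals_locally_finite[of s]])
    (use arrival_le_init_time in \<open>auto intro: order_trans\<close>)

lemma init_time_le_iff: "init_time r k \<le> s \<longleftrightarrow> k < card {k. init_time r k \<le> s}"
  by (rule mono_le_iff_less_card[OF mono_init_time finite_initiations])

text \<open>FCFS is in force and a customer is waiting at \<open>s\<close>, so only the lack of a
  free server delays the start: it happens when the first server becomes free.\<close>

lemma waiting_init_step:
  assumes "T \<le> s" "t n \<le> s" "s < init_time (RA_then_FCFS T) n"
  obtains j where "j < c" "\<And>k. k < c \<Longrightarrow> free_at (state (RA_then_FCFS T) n) j \<le> free_at (state (RA_then_FCFS T) n) k"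
    "free_at (state (RA_then_FCFS T) n) j = init_time (RA_then_FCFS T) n"
    "free_at (state (RA_then_FCFS T) (Suc n)) =
      (free_at (state (RA_then_FCFS T) n))(j := init_time (RA_then_FCFS T) n + S n)"
proof -
  let ?r = "RA_then_FCFS T"
  let ?q = "state ?r n"
  let ?i = "LEAST i. i \<notin> initiated ?q"
  \<comment> \<open>Only \<open>n\<close> customers have been initiated, so one of the first
    \<open>n + 1\<close> is left.\<close>
  have "\<not> {..n} \<subseteq> initiated ?q"
    using card_mono[OF finite_initiated, of "{..n}" ?r n] by (auto simp: card_initiated)
  then obtain i where "i \<le> n" "i \<notin> initiated ?q" by auto
  then have "?i \<le> n" by (metis (mono_tags, lifting) Least_le order_trans)
  then have "t ?i \<le> s" using monoD[OF arrivals_mono] assms(2) by (meson order_trans)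
  moreover have "init_time ?r n = max T (max (t ?i) (Min (free_at ?q ` {..<c})))"
    using assms(1,3) by (auto simp: initiation_time_def fcfs_next_def Let_def split: if_splits)
  ultimately have eq: "init_time ?r n = Min (free_at ?q ` {..<c})"
    using assms(1,3) by (auto simp: max_def split: if_splits)
  obtain j where j: "j < c" "free_at ?q j \<le> init_time ?r n"
    "free_at (state ?r (Suc n)) = (free_at ?q)(j := init_time ?r n + S n)"
    using init_stepE[of ?r n] by metis
  have least: "init_time ?r n \<le> free_at ?q k" if "k < c" for k
    using that eq by simp
  show ?thesis
    by (rule that[of j]) (use j least in \<open>auto intro: order_trans antisym\<close>)
qed

text \<open>Each waiting customer will start on the server that is free first, which is the smallest
  coordinate; the recursion thus runs the system ahead until all arrivals by \<open>s\<close> are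
  initiated.\<close>

lemma workload_eq_residuals:
  assumes "T \<le> s"
  shows "workload c t S a (RA_then_FCFS T) s =
    residuals (state (RA_then_FCFS T) (card {i. t i \<le> s})) s"
proof -
  let ?r = "RA_then_FCFS T"
  let ?n = "card {k. init_time ?r k \<le> s}" and ?A = "card {i. t i \<le> s}"
  have le: "?n \<le> ?A"
    by (rule card_mono[OF arrivals_locally_finite])
      (use arrival_le_init_time in \<open>auto intro: order_trans\<close>)
  have "m \<le> ?A \<longrightarrow>
      fold (\<lambda>k. add_to_smallest (S k)) [?n..<m] (residuals (state ?r ?n) s) =
      residuals (state ?r m) s" if "?n \<le> m" for m
    using that
  proof (induction m rule: dec_induct)
    case (step m)
    show ?case
    proof
      assume "Suc m \<le> ?A"
      let ?q = "state ?r m"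
      have "t m \<le> s" using arrived_iff[of m s] \<open>Suc m \<le> ?A\<close> by simp
      moreover have s: "s < init_time ?r m"
        using init_time_le_iff[of ?r m s] step(1) by simp
      ultimately obtain j where j: "j < c" "\<And>k. k < c \<Longrightarrow> free_at ?q j \<le> free_at ?q k"
        "free_at ?q j = init_time ?r m"
        "free_at (state ?r (Suc m)) = (free_at ?q)(j := init_time ?r m + S m)"
        using waiting_init_step[OF assms] by metis
      let ?g = "\<lambda>j. max 0 (free_at ?q j - s)"
      have "add_to_smallest (S m) (residuals ?q s) = sort (map (?g(j := ?g j + S m)) [0..<c])"
        unfolding residuals_def
        by (rule add_to_smallest_sort[OF j(1)]) (use j(2) in force)
      \<comment> \<open>The server \<open>j\<close> is free only after \<open>s\<close>, so
        truncation at 0 is inactive there and commutes with adding \<open>S m\<close>.\<close>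
      also have "?g(j := ?g j + S m) = (\<lambda>k. max 0 (free_at (state ?r (Suc m)) k - s))"
        using j s durations_nonneg[of m] by (auto simp del: state_after.simps)
      finally show "fold (\<lambda>k. add_to_smallest (S k)) [?n..<Suc m] (residuals (state ?r ?n) s) =
          residuals (state ?r (Suc m)) s"
        using step \<open>Suc m \<le> ?A\<close> by (simp add: residuals_def del: state_after.simps)
    qed
  qed simp
  from this[OF le] show ?thesis
    by (simp add: workload_def Let_def residuals_def)
qed

text \<open>\<open>busy q (s + y)\<close> counts the residuals above \<open>y\<close>, but only for
  \<open>y \<ge> 0\<close>; the threshold, itself a residual, meets this.\<close>

lemma residuals_nth_le:
  assumes k: "k < c" and le: "\<And>y. s \<le> y \<Longrightarrow> busy q y \<le> busy q' y"
  shows "residuals q s ! k \<le> residuals q' s ! k"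
proof -
  have count: "size {#x \<in># mset (residuals q s). y < x#} = busy q (s + y)" if "0 \<le> y" for q y
  proof -
    have "size {#x \<in># mset (residuals q s). y < x#} =
        length (filter (\<lambda>x. y < x) (map (\<lambda>j. max 0 (free_at q j - s)) [0..<c]))"
      by (simp add: residuals_def del: mset_map flip: mset_filter)
    also have "\<dots> = card {j. j < c \<and> y < max 0 (free_at q j - s)}"
      by (auto simp: length_filter_conv_card intro!: arg_cong[where f = card])
    also have "\<dots> = busy q (s + y)"
      using that by (auto simp: busy_def less_max_iff_disj algebra_simps intro!: arg_cong[where f = card])
    finally show ?thesis .
  qed
  have len: "length (residuals q s) = c" for q by (simp add: residuals_def)
  have "residuals q' s ! k \<in> set (residuals q' s)"
    using k by (simp add: len)
  then have nonneg: "0 \<le> residuals q' s ! k" by (auto simp: residuals_def)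
  show ?thesis
    by (rule sorted_nth_le_nth)
      (use k le nonneg in \<open>simp_all add: len count, simp_all add: residuals_def\<close>)
qed

text \<open>Both vectors are residuals after the same number \<open>?A\<close> of initiations, so it
  suffices to compare \<open>busy\<close> at all \<open>y \<ge> s\<close>.\<close>

lemma workload_nth_le:
  assumes "T' \<le> T" "T \<le> s" "k < c"
  shows "workload c t S a (RA_then_FCFS T') s ! k \<le> workload c t S a (RA_then_FCFS T) s ! k"
proof -
  let ?r = "RA_then_FCFS T" and ?A = "card {i. t i \<le> s}"
  have r: "later_switch ?r T'" using assms(1) by (rule later_switch.intros)
  have "busy (state (RA_then_FCFS T') ?A) y \<le> busy (state ?r ?A) y" if "s \<le> y" for y
  proof (cases "\<forall>m<?A. init_time ?r m \<le> y")
    case True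
    then show ?thesis using busy_le[OF r] by blast
  next
    case False
    \<comment> \<open>All servers of the slower system are then committed beyond \<open>y\<close>, since its waiting
      customers start on the server that is free first.\<close>
    then obtain m where m: "m < ?A" "y < init_time ?r m" by (auto simp: not_le)
    then obtain n where n: "?A = Suc n" "m \<le> n" by (metis less_Suc_eq_le Suc_pred' gr0I not_less0)
    have y: "y < init_time ?r n"
      using m n monoD[OF mono_init_time] by (meson less_le_trans)
    have "t n \<le> s" using arrived_iff[of n s] n by simp
    moreover have "s < init_time ?r n" using y \<open>s \<le> y\<close> by simp
    ultimately obtain j where j: "\<And>k. k < c \<Longrightarrow> free_at (state ?r n) j \<le> free_at (state ?r n) k"
        "free_at (state ?r n) j = init_time ?r n"
      using waiting_init_step[OF assms(2)] by metis
    have "y < free_at (state ?r ?A) k" if "k < c" for k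
    proof -
      have "free_at (state ?r n) k \<le> free_at (state ?r ?A) k"
        using state_le_Suc[of ?r n] unfolding n(1) state_le_def le_fun_def by blast
      with y j(1)[OF that] j(2) show ?thesis by linarith
    qed
    then have "\<not> busy (state ?r ?A) y < c" by (auto simp: busy_less_iff not_le)
    moreover have "busy (state (RA_then_FCFS T') ?A) y \<le> card {..<c}"
      unfolding busy_def by (rule card_mono) auto
    ultimately show ?thesis by simp
  qed
  then have "residuals (state (RA_then_FCFS T') ?A) s ! k \<le> residuals (state ?r ?A) s ! k"
    by (intro residuals_nth_le assms)
  then show ?thesis
    using assms by (simp add: workload_eq_residuals)
qed

text \<open>No RA start precedes time 0, so a switch at 0 never uses RA.\<close>

lemma FCFS_eq_switch_at_0:
  "initiation_time c t S a FCFS = initiation_time c t S a (RA_then_FCFS 0)"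
  "departure_time c t S a FCFS = departure_time c t S a (RA_then_FCFS 0)"
  "workload c t S a FCFS = workload c t S a (RA_then_FCFS 0)"
proof -
  have nonneg: "0 \<le> ra_time q" if "finite (initiated q)" for q
    using ra_next_eq[OF that] arrivals_nonneg by (metis fst_conv max.coboundedI1)
  have st: "state FCFS n = state (RA_then_FCFS 0) n" for n
  proof (induction n)
    case (Suc n)
    with nonneg[OF finite_initiated[of "RA_then_FCFS 0" n]] show ?case by simp
  qed simp
  show it: "initiation_time c t S a FCFS = initiation_time c t S a (RA_then_FCFS 0)"
    using nonneg[OF finite_initiated[of "RA_then_FCFS 0"]]
    by (simp add: initiation_time_def st fun_eq_iff flip: not_le)
  show "departure_time c t S a FCFS = departure_time c t S a (RA_then_FCFS 0)"
    by (simp add: departure_time_def fun_eq_iff it)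
  show "workload c t S a FCFS = workload c t S a (RA_then_FCFS 0)"
    by (simp add: workload_def fun_eq_iff it st)
qed

end

theorem theorem3p3:
  fixes c :: nat and t S :: "nat \<Rightarrow> real" and a :: "nat \<Rightarrow> nat" and T' T :: real
  assumes servers: "c \<ge> 1"
    and assignment: "\<And>i. a i < c"
    and arrivals_nonneg: "\<And>i. 0 \<le> t i"
    and arrivals_mono: "mono t"
    and arrivals_locally_finite: "\<And>x. finite {i. t i \<le> x}"
    and durations_nonneg: "\<And>n. 0 \<le> S n"
    and zeros_initial: "\<And>m n. m \<le> n \<Longrightarrow> 0 < S m \<Longrightarrow> 0 < S n"
    and times: "0 \<le> T'" "T' \<le> T"
  shows "dominates c t S a RA (RA_then_FCFS T) \<and>
         dominates c t S a (RA_then_FCFS T) (RA_then_FCFS T') \<and>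
         dominates c t S a (RA_then_FCFS T') FCFS \<and>
         (\<forall>s\<ge>T'. \<forall>k<c. workload c t S a FCFS s ! k \<le> workload c t S a (RA_then_FCFS T') s ! k) \<and>
         (\<forall>s\<ge>T. \<forall>k<c. workload c t S a (RA_then_FCFS T') s ! k \<le> workload c t S a (RA_then_FCFS T) s ! k)"
proof -
  interpret queue c t S a
    by unfold_locales (fact servers assignment arrivals_nonneg arrivals_mono
      arrivals_locally_finite durations_nonneg)+
  have "dominates c t S a (RA_then_FCFS T') FCFS"
    unfolding dominates_def FCFS_eq_switch_at_0
    using dominates_if_init_time_le[OF init_time_le[OF later_switch.intros(2)[OF times(1)]]]
    by (simp add: dominates_def)
  then show ?thesis
    using times unfolding FCFS_eq_switch_at_0
    by (blast intro: dominates_if_init_time_le init_time_le later_switch.intros workload_nth_le)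
qed

end
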